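(* 1. If $f_1,f_2\in\mathbb{R}^3$ are vector features, i.e. they transform with the standard representation of $\mathrm{SO}(3)$, then the tensor product $(f_1,f_2)\mapsto f_1f_2^T$ is an $\mathrm{SO}(3)$ output-bi-equivariant map. 2. Given a matrix $F\in\mathbb{R}^{3\times3}$ with distinct, positive singular values that transforms with the joint action of $\mathrm{SO}(3)\times \mathrm{SO}(3)$, i.e. $F\mapsto R_1FR_2^T$, the map $$F\mapsto\Big(\{U_i\sigma(\Sigma)\}_{i=1}^4,\ \{V_i\sigma'(\Sigma)\}_{i=1}^4\Big)$$ is an $\mathrm{SO}(3)$ input-bi-equivariant map, where $\{(U_i,\Sigma,V_i)\}_{i=1}^4$ are the 4 possible SVD decompositions of $F$ counting signs, with $U_i,V_i\in \mathrm{SO}(3)$ if $\det(F)>0$, and $U_i\in \mathrm{O}(3)-\mathrm{SO}(3)$, $V_i\in \mathrm{SO}(3)$ if $\det(F)<0$, and $\sigma,\sigma'$ are point-wise non-linearities on the singular values. The $\mathrm{SO}(3)$ matrices are formed as $[u_1,u_2,u_1\times u_2]$ and the $\mathrm{O}(3)-\mathrm{SO}(3)$ matrices as $[u_1,u_2,-u_1\times u_2]$, where $u_1,u_2$ are the first two columns of $U$ (and similarly for $V$). 3. Given the same matrix $F\neq0$ as in item 2 (distinct, positive singular values, transforming as $F\mapsto R_1FR_2^T$), the map $F\mapsto\sigma(\|F\|)\frac{F}{\|F\|}$ is $\mathrm{SO}(3)$ input-output bi-equivariant, where $\|\cdot\|$ is a matrix norm, e.g. operator, Frobenius, trace norm,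 etc.
   Context: $R_1,R_2\in \mathrm{SO}(3)$ are independent rotations, and the joint action of $\mathrm{SO}(3)\times \mathrm{SO}(3)$ on $\mathbb{R}^{3\times3}$ is $(R_1,R_2):F\mapsto R_1FR_2^T=R_1FR_2^{-1}$. An SVD decomposition $(U,\Sigma,V)$ of $F$ means $F=U\Sigma V^T$ with $U,V$ orthogonal and $\Sigma$ the diagonal matrix of singular values. $\mathrm{O}(3)-\mathrm{SO}(3)$ denotes the orthogonal matrices of determinant $-1$. In item 2, $\sigma(\Sigma)$ and $\sigma'(\Sigma)$ mean that $\sigma,\sigma'$ are applied to each singular value; in item 3, $\sigma$ is a scalar non-linearity applied to $\|F\|$. A rotation $R$ acts on a set of four matrices by $R\cdot\{A_1,A_2,A_3,A_4\}=\{RA_1,RA_2,RA_3,RA_4\}$. For a group $G$ (here $\mathrm{SO}(3)$) and all $(g_1,g_2)\in G\times G$: a map $f:S_1\times S_2\to S_3$ is output-bi-equivariant if $f(g_1s_1,g_2s_2)=g_1f(s_1,s_2)g_2^{-1}$ for all $(s_1,s_2)$; a map $f:S_1\to S_2\times S_3$, $f(s_1)=(s_2,s_3)$, is input-bi-equivariant if $f(g_1s_1g_2^{-1})=(g_1s_2,g_2s_3)$ for all $s_1$; a map $f:S_1\to S_2$ is input-output bi-equivariant if $f(g_1s_1g_2^{-1})=g_1f(s_1)g_2^{-1}$ for all $s_1$.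
   Formalization: In item 3, "matrix norm" is restricted to orthogonally invariant norms (operator, Frobenius and trace norm are covered explicitly); for an arbitrary matrix norm, such as the largest absolute entry or maximal column sum, the claim is false. *)

theory Defs
  imports "HOL-Analysis.Analysis"
begin

definition SO3 :: "(real^3^3) set" where
  "SO3 = {R. rotation_matrix R}"

definition O3 :: "(real^3^3) set" where
  "O3 = {Q. orthogonal_matrix Q}"

text \<open>The joint action of \<open>SO(3) \<times> SO(3)\<close>; on orthogonal matrices the transpose is the inverse.\<close>

definition joint_act :: "real^3^3 \<Rightarrow> real^3^3 \<Rightarrow> real^3^3 \<Rightarrow> real^3^3" where
  "joint_act R1 R2 F = R1 ** F ** transpose R2"

definition set_act :: "real^3^3 \<Rightarrow> (real^3^3) set \<Rightarrow> (real^3^3) set" where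
  "set_act R X = (\<lambda>A. R ** A) ` X"

text \<open>
  In the three notions of bi-equivariance, \<open>G\<close> is the underlying set of the group, a one-sided
  action \<open>g s\<close> is a function \<open>act g s\<close>, and a joint action \<open>g\<^sub>1 s g\<^sub>2\<^sup>-\<^sup>1\<close> is a function
  \<open>jact g\<^sub>1 g\<^sub>2 s\<close>. Domains are explicit sets, which are required to be stable under the action;
  codomains are whole types.
\<close>

definition output_bi_equivariant ::
  "'g set \<Rightarrow> ('g \<Rightarrow> 'a \<Rightarrow> 'a) \<Rightarrow> ('g \<Rightarrow> 'b \<Rightarrow> 'b) \<Rightarrow> ('g \<Rightarrow> 'g \<Rightarrow> 'c \<Rightarrow> 'c) \<Rightarrow>
   'a set \<Rightarrow> 'b set \<Rightarrow> ('a \<Rightarrow> 'b \<Rightarrow> 'c) \<Rightarrow> bool" where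
  "output_bi_equivariant G act1 act2 jact S1 S2 f \<longleftrightarrow>
     (\<forall>g1\<in>G. \<forall>g2\<in>G. \<forall>s1\<in>S1. \<forall>s2\<in>S2.
        act1 g1 s1 \<in> S1 \<and> act2 g2 s2 \<in> S2 \<and>
        f (act1 g1 s1) (act2 g2 s2) = jact g1 g2 (f s1 s2))"

definition input_bi_equivariant ::
  "'g set \<Rightarrow> ('g \<Rightarrow> 'g \<Rightarrow> 'a \<Rightarrow> 'a) \<Rightarrow> ('g \<Rightarrow> 'b \<Rightarrow> 'b) \<Rightarrow> ('g \<Rightarrow> 'c \<Rightarrow> 'c) \<Rightarrow>
   'a set \<Rightarrow> ('a \<Rightarrow> 'b \<times> 'c) \<Rightarrow> bool" where
  "input_bi_equivariant G jact act2 act3 S1 f \<longleftrightarrow>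
     (\<forall>g1\<in>G. \<forall>g2\<in>G. \<forall>s1\<in>S1.
        jact g1 g2 s1 \<in> S1 \<and>
        f (jact g1 g2 s1) = (act2 g1 (fst (f s1)), act3 g2 (snd (f s1))))"

definition input_output_bi_equivariant ::
  "'g set \<Rightarrow> ('g \<Rightarrow> 'g \<Rightarrow> 'a \<Rightarrow> 'a) \<Rightarrow> ('g \<Rightarrow> 'g \<Rightarrow> 'b \<Rightarrow> 'b) \<Rightarrow>
   'a set \<Rightarrow> ('a \<Rightarrow> 'b) \<Rightarrow> bool" where
  "input_output_bi_equivariant G jact1 jact2 S1 f \<longleftrightarrow>
     (\<forall>g1\<in>G. \<forall>g2\<in>G. \<forall>s1\<in>S1.
        jact1 g1 g2 s1 \<in> S1 \<and> f (jact1 g1 g2 s1) = jact2 g1 g2 (f s1))"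

definition tensor_product :: "real^3 \<Rightarrow> real^3 \<Rightarrow> real^3^3" where
  "tensor_product f1 f2 = (columnvector f1 :: real^1^3) ** (rowvector f2 :: real^3^1)"

definition singular_value :: "real^3^3 \<Rightarrow> real \<Rightarrow> bool" where
  "singular_value F s \<longleftrightarrow>
     s \<ge> 0 \<and> (\<exists>v. v \<noteq> 0 \<and> (transpose F ** F) *v v = s\<^sup>2 *\<^sub>R v)"

text \<open>There are three singular values with multiplicity, so they are distinct iff the set of
  singular values has three elements.\<close>

definition distinct_pos_sv :: "(real^3^3) set" where
  "distinct_pos_sv =
     {F. card {s. singular_value F s} = 3 \<and> (\<forall>s. singular_value F s \<longrightarrow> s > 0)}"

text \<open>The singular values on the diagonal are listed in decreasing order, as usual; this is what
  makes an SVD of a matrix with distinct singular values unique up to signs.\<close>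

definition is_svd :: "real^3^3 \<Rightarrow> real^3^3 \<Rightarrow> real^3^3 \<Rightarrow> real^3^3 \<Rightarrow> bool" where
  "is_svd F U S V \<longleftrightarrow>
     F = U ** S ** transpose V \<and> U \<in> O3 \<and> V \<in> O3 \<and>
     (\<forall>i j. i \<noteq> j \<longrightarrow> S $ i $ j = 0) \<and>
     S$1$1 \<ge> S$2$2 \<and> S$2$2 \<ge> S$3$3 \<and> S$3$3 \<ge> 0"

definition oriented_svds :: "real^3^3 \<Rightarrow> ((real^3^3) \<times> (real^3^3) \<times> (real^3^3)) set" where
  "oriented_svds F =
     {(U, S, V). is_svd F U S V \<and>
        (det F > 0 \<longrightarrow> U \<in> SO3 \<and> V \<in> SO3) \<and>
        (det F < 0 \<longrightarrow> U \<in> O3 - SO3 \<and> V \<in> SO3)}"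

text \<open>Only the diagonal is transformed: the zeros off the diagonal stay zero even if
  \<open>\<sigma> 0 \<noteq> 0\<close>.\<close>

definition diag_apply :: "(real \<Rightarrow> real) \<Rightarrow> real^3^3 \<Rightarrow> real^3^3" where
  "diag_apply \<sigma> S = (\<chi> i j. if i = j then \<sigma> (S $ i $ i) else 0)"

definition svd_map :: "(real \<Rightarrow> real) \<Rightarrow> (real \<Rightarrow> real) \<Rightarrow> real^3^3 \<Rightarrow>
    (real^3^3) set \<times> (real^3^3) set" where
  "svd_map \<sigma> \<sigma>' F =
     ({U ** diag_apply \<sigma> S | U S V. (U, S, V) \<in> oriented_svds F},
      {V ** diag_apply \<sigma>' S | U S V. (U, S, V) \<in> oriented_svds F})"

text \<open>The matrix \<open>[a, b, c]\<close> with columns \<open>a\<close>, \<open>b\<close>, \<open>c\<close>.\<close>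

definition of_columns :: "real^3 \<Rightarrow> real^3 \<Rightarrow> real^3 \<Rightarrow> real^3^3" where
  "of_columns a b c = transpose (vector [a, b, c])"

text \<open>
  ``Matrix norm'' is read as orthogonally invariant matrix norm: for an arbitrary norm on matrices,
  such as the largest absolute value of an entry, the function \<open>norm_map\<close> below is not
  equivariant.
\<close>

definition orthogonally_invariant_norm :: "(real^3^3 \<Rightarrow> real) \<Rightarrow> bool" where
  "orthogonally_invariant_norm N \<longleftrightarrow>
     (\<forall>A. N A \<ge> 0) \<and> (\<forall>A. N A = 0 \<longleftrightarrow> A = 0) \<and>
     (\<forall>c A. N (c *\<^sub>R A) = \<bar>c\<bar> * N A) \<and>
     (\<forall>A B. N (A + B) \<le> N A + N B) \<and>
     (\<forall>A. \<forall>P\<in>O3. \<forall>Q\<in>O3. N (P ** A ** Q) = N A)"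

definition operator_norm :: "real^3^3 \<Rightarrow> real" where
  "operator_norm F = onorm ((*v) F)"

text \<open>The norm of the type \<open>real^3^3\<close> is the Euclidean norm of the nine entries.\<close>

definition frobenius_norm :: "real^3^3 \<Rightarrow> real" where
  "frobenius_norm F = norm F"

text \<open>The sum of the singular values with multiplicity. Every matrix has an SVD, and the diagonal
  factor, being sorted, is the same in all of them.\<close>

definition trace_norm :: "real^3^3 \<Rightarrow> real" where
  "trace_norm F = trace (THE S. \<exists>U V. is_svd F U S V)"

definition norm_map :: "(real^3^3 \<Rightarrow> real) \<Rightarrow> (real \<Rightarrow> real) \<Rightarrow> real^3^3 \<Rightarrow> real^3^3" where
  "norm_map N \<sigma> F = \<sigma> (N F) *\<^sub>R (F /\<^sub>R N F)"

end

theory Submission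
  imports Defs
begin

text \<open>
  The joint action of \<open>(R\<^sub>1, R\<^sub>2)\<close> carries an SVD \<open>(U, \<Sigma>, V)\<close> of \<open>F\<close> to the SVD
  \<open>(R\<^sub>1U, \<Sigma>, R\<^sub>2V)\<close> of \<open>R\<^sub>1FR\<^sub>2\<^sup>T\<close> and preserves determinants, and this is all that
  equivariance needs. For the count, let \<open>(U, \<Sigma>, V)\<close> and \<open>(U', \<Sigma>', V')\<close> be two SVDs of \<open>F\<close>.
  The sorted diagonals agree, and \<open>F\<^sup>TF = V\<Sigma>\<^sup>2V\<^sup>T = V'\<Sigma>\<^sup>2V'\<^sup>T\<close> makes \<open>D = V\<^sup>TV'\<close> commute with
  \<open>\<Sigma>\<^sup>2\<close>, whose entries are distinct; so \<open>D\<close> is a diagonal matrix of signs, and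
  \<open>V' = VD\<close>, \<open>U' = UD\<close>. Of the eight sign patterns, \<open>det V' = 1\<close> selects four, and then
  \<open>det U'\<close> is the sign of \<open>det F\<close>.
\<close>

section \<open>Diagonal matrices\<close>

text \<open>A diagonal matrix is given by its vector of entries, so that singular values and sign
  patterns can be handled as vectors.\<close>

definition diag_mat :: "real^'n \<Rightarrow> real^'n^'n" where
  "diag_mat d = (\<chi> i j. if i = j then d $ i else 0)"

lemma diag_mat_nth [simp]: "diag_mat d $ i $ j = (if i = j then d $ i else 0)"
  by (simp add: diag_mat_def)

lemma transpose_diag_mat [simp]: "transpose (diag_mat d) = diag_mat d"
  by (simp add: transpose_def vec_eq_iff)

lemma matrix_mult_diag_mat_nth [simp]: "(A ** diag_mat d) $ i $ j = A $ i $ j * d $ j"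
  by (simp add: matrix_matrix_mult_def if_distrib [of "\<lambda>z. _ * z"] cong: if_cong)

lemma diag_mat_mult_matrix_nth [simp]: "(diag_mat d ** A) $ i $ j = d $ i * A $ i $ j"
  by (simp add: matrix_matrix_mult_def if_distrib [of "\<lambda>z. z * _"] cong: if_cong)

lemma diag_mat_mult_vector_nth [simp]: "(diag_mat d *v x) $ i = d $ i * x $ i"
  by (simp add: matrix_vector_mult_def if_distrib [of "\<lambda>z. z * _"] cong: if_cong)

lemma diag_mat_mult_diag_mat: "diag_mat d ** diag_mat e = diag_mat (\<chi> i. d $ i * e $ i)"
  by (simp add: vec_eq_iff)

lemma det_diag_mat: "det (diag_mat (d :: real^3)) = d $ 1 * d $ 2 * d $ 3"
  by (simp add: det_3)

lemma orthogonal_diag_mat_iff: "orthogonal_matrix (diag_mat d) \<longleftrightarrow> (\<forall>i. d $ i = 1 \<or> d $ i = - 1)"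
  by (auto simp: orthogonal_matrix vec_eq_iff mat_def square_eq_1_iff)

section \<open>Orthogonal matrices and the Euclidean norm\<close>

lemma transpose_mult_self_orthogonal:
  "orthogonal_matrix Q \<Longrightarrow> transpose Q ** Q = mat 1"
  "orthogonal_matrix Q \<Longrightarrow> Q ** transpose Q = mat 1"
  by (simp_all add: orthogonal_matrix_def)

lemma orthogonal_matrix_cancel:
  assumes "orthogonal_matrix Q"
  shows "A ** Q ** transpose Q = A" "A ** transpose Q ** Q = A"
  using transpose_mult_self_orthogonal [OF assms]
  by (simp_all flip: matrix_mul_assoc)

lemma orthogonal_matrix_cancel_left:
  assumes "orthogonal_matrix Q"
  shows "Q ** (transpose Q ** A) = A" "transpose Q ** (Q ** A) = A"
  using transpose_mult_self_orthogonal [OF assms]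
  by (simp_all add: matrix_mul_assoc)

lemma norm_orthogonal_matrix_vector:
  fixes Q :: "real^'n^'n"
  assumes "orthogonal_matrix Q"
  shows "norm (Q *v x) = norm x"
proof -
  have "(Q *v x) \<bullet> (Q *v x) = x \<bullet> (transpose Q *v (Q *v x))"
    by (metis dot_lmul_matrix inner_commute transpose_matrix_vector)
  also have "\<dots> = x \<bullet> x"
    using transpose_mult_self_orthogonal(1) [OF assms]
    by (simp add: matrix_vector_mul_assoc del: transpose_matrix_vector)
  finally show ?thesis
    by (simp add: norm_eq)
qed

text \<open>Each row of \<open>A ** transpose Q\<close> is \<open>Q\<close> applied to the
  corresponding row of \<open>A\<close>, so row norms are preserved.\<close>

lemma norm_orthogonal_mult:
  fixes A :: "real^'n^'m" and Q :: "real^'n^'n"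
  assumes "orthogonal_matrix Q"
  shows "norm (A ** transpose Q) = norm A"
proof -
  have "(A ** transpose Q) $ i = Q *v A $ i" for i
    by (simp add: vec_eq_iff matrix_matrix_mult_def matrix_vector_mult_def transpose_def mult.commute)
  then show ?thesis
    by (simp add: norm_vec_def [of "A ** transpose Q"] norm_vec_def [of A]
        norm_orthogonal_matrix_vector assms)
qed

lemma norm_transpose: "norm (transpose A) = norm (A :: real^'n^'m)"
  unfolding norm_eq inner_vec_def transpose_def by simp (rule sum.swap)

section \<open>The joint action and the tensor product\<close>

lemma SO3_iff: "R \<in> SO3 \<longleftrightarrow> R \<in> O3 \<and> det R = 1"
  by (simp add: SO3_def O3_def rotation_matrix_def)

lemma O3_det: "Q \<in> O3 \<Longrightarrow> det Q = 1 \<or> det Q = - 1"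
  by (simp add: O3_def det_orthogonal_matrix)

lemma O3_mult: "P \<in> O3 \<Longrightarrow> Q \<in> O3 \<Longrightarrow> P ** Q \<in> O3"
  by (simp add: O3_def orthogonal_matrix_mul)

lemma O3_transpose_iff [simp]: "transpose Q \<in> O3 \<longleftrightarrow> Q \<in> O3"
  by (simp add: O3_def)

text \<open>The inverse action: it upgrades one-sided transport statements to equivalences and
  equalities.\<close>

lemma joint_act_transpose_cancel:
  assumes "R1 \<in> O3" "R2 \<in> O3"
  shows "joint_act (transpose R1) (transpose R2) (joint_act R1 R2 F) = F"
  using assms
  by (simp add: joint_act_def O3_def orthogonal_matrix_cancel transpose_mult_self_orthogonal
      matrix_mul_assoc)

lemma joint_act_scaleR: "joint_act R1 R2 (c *\<^sub>R F) = c *\<^sub>R joint_act R1 R2 F"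
  by (simp add: joint_act_def vec_eq_iff matrix_matrix_mult_def sum_distrib_left mult_ac)

lemma det_joint_act: "R1 \<in> SO3 \<Longrightarrow> R2 \<in> SO3 \<Longrightarrow> det (joint_act R1 R2 F) = det F"
  by (simp add: joint_act_def det_mul SO3_iff det_transpose)

lemma tensor_product_output_bi_equivariant:
  "output_bi_equivariant SO3 (*v) (*v) joint_act UNIV UNIV tensor_product"
proof -
  have col: "columnvector (R *v x) = R ** (columnvector x :: real^1^3)" for R :: "real^3^3" and x
    by (simp add: columnvector_def matrix_matrix_mult_def matrix_vector_mult_def vec_eq_iff)
  then have "rowvector (R *v x) = (rowvector x :: real^3^1) ** transpose R"
    for R :: "real^3^3" and x
    by (metis matrix_transpose_mul transpose_columnvector)
  with col show ?thesis
    by (simp add: output_bi_equivariant_def tensor_product_def joint_act_def matrix_mul_assoc)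
qed

section \<open>Singular values and SVDs under the joint action\<close>

text \<open>The Gram matrix \<open>transpose F ** F\<close> is conjugated by \<open>R2\<close>, so
  an eigenvector \<open>v\<close> becomes the eigenvector \<open>R2 *v v\<close> with the same
  eigenvalue.\<close>

lemma singular_value_joint_act_imp:
  assumes R: "R1 \<in> O3" "R2 \<in> O3" and s: "singular_value F s"
  shows "singular_value (joint_act R1 R2 F) s"
proof -
  obtain v where v: "v \<noteq> 0" "(transpose F ** F) *v v = s\<^sup>2 *\<^sub>R v" and "s \<ge> 0"
    using s by (auto simp: singular_value_def)
  have "norm (R2 *v v) = norm v"
    using R by (simp add: O3_def norm_orthogonal_matrix_vector)
  with v have "R2 *v v \<noteq> 0"
    by auto
  moreover have "transpose (joint_act R1 R2 F) ** joint_act R1 R2 F ** R2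
      = R2 ** (transpose F ** F)"
    using R by (simp add: joint_act_def O3_def matrix_transpose_mul orthogonal_matrix_cancel
        orthogonal_matrix_cancel_left transpose_mult_self_orthogonal flip: matrix_mul_assoc)
  then have "(transpose (joint_act R1 R2 F) ** joint_act R1 R2 F) *v (R2 *v v)
      = s\<^sup>2 *\<^sub>R (R2 *v v)"
    by (metis matrix_vector_mul_assoc matrix_vector_mult_scaleR v(2))
  ultimately show ?thesis
    using \<open>s \<ge> 0\<close> by (auto simp: singular_value_def)
qed

lemma singular_value_joint_act:
  assumes "R1 \<in> O3" "R2 \<in> O3"
  shows "singular_value (joint_act R1 R2 F) s \<longleftrightarrow> singular_value F s"
  using singular_value_joint_act_imp [of R1 R2 F]
    singular_value_joint_act_imp [of "transpose R1" "transpose R2" "joint_act R1 R2 F"] assms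
  by (auto simp: joint_act_transpose_cancel)

lemma distinct_pos_sv_joint_act:
  assumes "R1 \<in> O3" "R2 \<in> O3"
  shows "joint_act R1 R2 F \<in> distinct_pos_sv \<longleftrightarrow> F \<in> distinct_pos_sv"
  unfolding distinct_pos_sv_def mem_Collect_eq singular_value_joint_act [OF assms] ..

lemma is_svd_joint_act:
  assumes "R1 \<in> O3" "R2 \<in> O3" "is_svd F U S V"
  shows "is_svd (joint_act R1 R2 F) (R1 ** U) S (R2 ** V)"
  using assms
  by (auto simp: is_svd_def joint_act_def matrix_transpose_mul matrix_mul_assoc O3_mult)

lemma oriented_svds_joint_act_imp:
  assumes R: "R1 \<in> SO3" "R2 \<in> SO3" and "(U, S, V) \<in> oriented_svds F"
  shows "(R1 ** U, S, R2 ** V) \<in> oriented_svds (joint_act R1 R2 F)"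
  using assms det_joint_act [OF R]
  by (auto simp: oriented_svds_def SO3_iff det_mul O3_mult intro: is_svd_joint_act)

lemma oriented_svds_joint_act:
  assumes R: "R1 \<in> SO3" "R2 \<in> SO3"
  shows "oriented_svds (joint_act R1 R2 F) = (\<lambda>(U, S, V). (R1 ** U, S, R2 ** V)) ` oriented_svds F"
proof (intro equalityI subsetI)
  fix x assume "x \<in> oriented_svds (joint_act R1 R2 F)"
  moreover obtain U S V where x: "x = (U, S, V)"
    by (cases x)
  ultimately have "(transpose R1 ** U, S, transpose R2 ** V) \<in> oriented_svds F"
    using oriented_svds_joint_act_imp [of "transpose R1" "transpose R2" U S V "joint_act R1 R2 F"] R
    by (simp add: joint_act_transpose_cancel SO3_iff det_transpose)
  moreover have "x = (R1 ** (transpose R1 ** U), S, R2 ** (transpose R2 ** V))"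
    using R x by (simp add: SO3_iff O3_def orthogonal_matrix_cancel_left)
  ultimately show "x \<in> (\<lambda>(U, S, V). (R1 ** U, S, R2 ** V)) ` oriented_svds F"
    by force
qed (use oriented_svds_joint_act_imp [OF R] in auto)

lemma svd_map_input_bi_equivariant:
  "input_bi_equivariant SO3 joint_act set_act set_act distinct_pos_sv (svd_map \<sigma> \<sigma>')"
proof -
  \<comment> \<open>Written as images of \<open>oriented_svds F\<close>, both components turn
    equivariance into a composition of images.\<close>
  have *: "svd_map \<sigma> \<sigma>' F = ((\<lambda>(U, S, V). U ** diag_apply \<sigma> S) ` oriented_svds F,
      (\<lambda>(U, S, V). V ** diag_apply \<sigma>' S) ` oriented_svds F)" for F
    by (force simp: svd_map_def)
  show ?thesis
    unfolding input_bi_equivariant_def * set_act_def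
    by (auto simp: oriented_svds_joint_act distinct_pos_sv_joint_act SO3_iff image_image
        case_prod_beta matrix_mul_assoc)
qed

section \<open>Invariance of the norms\<close>

text \<open>The same diagonal factors occur in the SVDs of both matrices, so the two definite
  descriptions have equal predicates.\<close>

lemma trace_norm_joint_act:
  assumes "R1 \<in> O3" "R2 \<in> O3"
  shows "trace_norm (joint_act R1 R2 F) = trace_norm F"
proof -
  have "(\<exists>U V. is_svd (joint_act R1 R2 F) U S V) \<longleftrightarrow> (\<exists>U V. is_svd F U S V)" for S
    using is_svd_joint_act [OF assms, of F]
      is_svd_joint_act [of "transpose R1" "transpose R2" "joint_act R1 R2 F"] assms
    by (auto simp: joint_act_transpose_cancel) blast+
  then show ?thesis
    by (simp add: trace_norm_def)
qed

lemma frobenius_norm_joint_act: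
  assumes "R1 \<in> O3" "R2 \<in> O3"
  shows "frobenius_norm (joint_act R1 R2 F) = frobenius_norm F"
proof -
  \<comment> \<open>Transposing moves the left factor to the right, where
    \<open>norm_orthogonal_mult\<close> applies.\<close>
  have "norm (R1 ** F ** transpose R2) = norm (transpose F ** transpose R1)"
    using assms by (metis O3_def mem_Collect_eq norm_orthogonal_mult norm_transpose
        matrix_transpose_mul)
  also have "\<dots> = norm F"
    using assms by (simp add: O3_def norm_orthogonal_mult norm_transpose)
  finally show ?thesis
    by (simp add: frobenius_norm_def joint_act_def)
qed

text \<open>The substitution of \<open>transpose R2 *v x\<close> for \<open>x\<close> is a
  norm-preserving bijection, so the supremum of the quotients runs over the same set.\<close>

lemma operator_norm_joint_act:
  assumes "R1 \<in> O3" "R2 \<in> O3"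
  shows "operator_norm (joint_act R1 R2 F) = operator_norm F"
proof -
  \<comment> \<open>At \<open>x = 0\<close> both quotients are 0 because division by zero gives
    0.\<close>
  have eq: "norm (joint_act R1 R2 F *v x) / norm x
      = norm (F *v (transpose R2 *v x)) / norm (transpose R2 *v x)" for x
    using assms
    by (simp add: joint_act_def O3_def norm_orthogonal_matrix_vector
        del: transpose_matrix_vector flip: matrix_vector_mul_assoc)
  have "surj ((*v) (transpose R2))"
    by (rule surjI [of _ "(*v) R2"])
      (use assms in \<open>simp add: O3_def matrix_vector_mul_assoc transpose_mult_self_orthogonal
        del: transpose_matrix_vector\<close>)
  then have "range (\<lambda>x. norm (F *v (transpose R2 *v x)) / norm (transpose R2 *v x))
      = range (\<lambda>x. norm (F *v x) / norm x)"
    using image_image [of "\<lambda>x. norm (F *v x) / norm x" "(*v) (transpose R2)" UNIV] by simp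
  then show ?thesis
    by (simp add: operator_norm_def onorm_def eq del: transpose_matrix_vector)
qed

lemma norm_map_input_output_bi_equivariant:
  assumes "orthogonally_invariant_norm N \<or> N \<in> {operator_norm, frobenius_norm, trace_norm}"
  shows "input_output_bi_equivariant SO3 joint_act joint_act
           {F \<in> distinct_pos_sv. F \<noteq> 0} (norm_map N \<sigma>)"
  unfolding input_output_bi_equivariant_def
proof (intro ballI conjI)
  fix R1 R2 F assume "R1 \<in> SO3" "R2 \<in> SO3" and F: "F \<in> {F \<in> distinct_pos_sv. F \<noteq> 0}"
  then have R: "R1 \<in> O3" "R2 \<in> O3"
    by (auto simp: SO3_iff)
  have "N (joint_act R1 R2 F) = N F"
    using assms
  proof
    assume "orthogonally_invariant_norm N"
    with R show ?thesis
      by (simp add: orthogonally_invariant_norm_def joint_act_def)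
  qed (use R in \<open>auto simp: operator_norm_joint_act frobenius_norm_joint_act
      trace_norm_joint_act\<close>)
  then show "norm_map N \<sigma> (joint_act R1 R2 F) = joint_act R1 R2 (norm_map N \<sigma> F)"
    by (simp add: norm_map_def joint_act_scaleR)
  \<comment> \<open>The inverse action fixes 0, so it could not bring 0 back to the nonzero
    \<open>F\<close>.\<close>
  have "joint_act R1 R2 F \<noteq> 0"
    using joint_act_transpose_cancel [OF R, of F] joint_act_scaleR [of _ _ 0 0] F by force
  with F R show "joint_act R1 R2 F \<in> {F \<in> distinct_pos_sv. F \<noteq> 0}"
    by (simp add: distinct_pos_sv_joint_act)
qed

section \<open>The third column of an orthogonal matrix\<close>

text \<open>An orthogonal matrix respects the cross product up to the factor \<open>det Q\<close>;
  applied to the first two basis vectors this yields the third column, since \<open>det Q\<close> is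
  its own inverse.\<close>

lemma O3_eq_of_columns:
  assumes "Q \<in> O3"
  shows "Q = of_columns (column 1 Q) (column 2 Q)
    (det Q *\<^sub>R cross3 (column 1 Q) (column 2 Q))"
proof -
  have "cross3 (column 1 Q) (column 2 Q) = det Q *\<^sub>R column 3 Q"
    using assms cross_orthogonal_matrix [of Q "axis 1 1" "axis 2 1"]
    by (simp add: O3_def cross_basis matrix_vector_mult_basis)
  then have "det Q *\<^sub>R cross3 (column 1 Q) (column 2 Q) = column 3 Q"
    using O3_det [OF assms] by auto
  then show ?thesis
    by (simp add: of_columns_def transpose_def column_def vec_eq_iff forall_3)
qed

section \<open>Uniqueness of the SVD up to signs\<close>

lemma is_svd_diag_mat:
  assumes "is_svd F U S V"
  shows "S = diag_mat (\<chi> i. S $ i $ i)"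
  using assms by (auto simp: is_svd_def vec_eq_iff)

lemma is_svd_gram:
  assumes "is_svd F U (diag_mat d) V"
  shows "transpose F ** F = V ** diag_mat (\<chi> i. (d $ i)\<^sup>2) ** transpose V"
proof -
  have "transpose F ** F = V ** (diag_mat d ** diag_mat d) ** transpose V"
    using assms by (simp add: is_svd_def O3_def matrix_transpose_mul
        orthogonal_matrix_cancel_left flip: matrix_mul_assoc)
  then show ?thesis
    by (simp add: diag_mat_mult_diag_mat power2_eq_square)
qed

text \<open>In the coordinates \<open>w = transpose V *v v\<close> the Gram matrix is diagonal with
  entries the squares of \<open>d\<close>. A nonzero coordinate of the eigenvector \<open>w\<close>
  then forces \<open>s\<close> and \<open>d $ i\<close> to have equal squares, and both are
  nonnegative.\<close>

lemma singular_value_svd_diag: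
  assumes svd: "is_svd F U (diag_mat d) V" and s: "singular_value F s"
  shows "s \<in> {d $ 1, d $ 2, d $ 3}"
proof -
  obtain v where v: "v \<noteq> 0" "(transpose F ** F) *v v = s\<^sup>2 *\<^sub>R v" and "s \<ge> 0"
    using s by (auto simp: singular_value_def)
  have V: "orthogonal_matrix V"
    using svd by (simp add: is_svd_def O3_def)
  define w where "w = transpose V *v v"
  have "norm w = norm v"
    using V by (simp add: w_def norm_orthogonal_matrix_vector del: transpose_matrix_vector)
  with v have "w \<noteq> 0"
    by auto
  then obtain i where i: "w $ i \<noteq> 0"
    by (auto simp: vec_eq_iff)
  have "transpose V ** (transpose F ** F) = diag_mat (\<chi> i. (d $ i)\<^sup>2) ** transpose V"
    unfolding is_svd_gram [OF svd] using V
    by (simp add: orthogonal_matrix_cancel_left flip: matrix_mul_assoc)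
  then have "diag_mat (\<chi> i. (d $ i)\<^sup>2) *v w = s\<^sup>2 *\<^sub>R w"
    unfolding w_def by (metis matrix_vector_mul_assoc matrix_vector_mult_scaleR v(2))
  then have "(d $ i)\<^sup>2 * w $ i = s\<^sup>2 * w $ i"
    by (simp add: vec_eq_iff)
  then have "(d $ i)\<^sup>2 = s\<^sup>2"
    using i by simp
  moreover have "d $ i \<ge> 0"
    using svd exhaust_3 [of i] by (auto simp: is_svd_def)
  ultimately have "s = d $ i"
    using \<open>s \<ge> 0\<close> by simp
  then show ?thesis
    using exhaust_3 [of i] by auto
qed

lemma singular_values_svd_diag:
  assumes F: "F \<in> distinct_pos_sv" and svd: "is_svd F U (diag_mat d) V"
  shows "{s. singular_value F s} = {d $ 1, d $ 2, d $ 3}"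
\<comment> \<open>One inclusion is known; equality follows by counting, as there are three singular
  values and at most three diagonal entries.\<close>
proof (rule card_seteq)
  show "card {d $ 1, d $ 2, d $ 3} \<le> card {s. singular_value F s}"
    using F by (simp add: distinct_pos_sv_def card_insert_if)
qed (use singular_value_svd_diag [OF svd] in auto)

lemma svd_diag_distinct:
  assumes F: "F \<in> distinct_pos_sv" and svd: "is_svd F U (diag_mat d) V"
  shows "d $ 1 > d $ 2" "d $ 2 > d $ 3" "d $ 3 > 0"
proof -
  have "card {d $ 1, d $ 2, d $ 3} = 3" and pos: "d $ 3 > 0"
    using F singular_values_svd_diag [OF assms] by (auto simp: distinct_pos_sv_def)
  then have "d $ 1 \<noteq> d $ 2 \<and> d $ 2 \<noteq> d $ 3"
    by (auto simp: card_insert_if split: if_splits)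
  then show "d $ 1 > d $ 2" "d $ 2 > d $ 3"
    using svd by (auto simp: is_svd_def)
  show "d $ 3 > 0" by fact
qed

text \<open>A strictly decreasing triple is determined by its set of entries, here the set of
  singular values.\<close>

lemma svd_diag_unique:
  assumes F: "F \<in> distinct_pos_sv"
    and svd: "is_svd F U (diag_mat d) V" and svd': "is_svd F U' (diag_mat d') V'"
  shows "d' = d"
proof -
  have "{d $ 1, d $ 2, d $ 3} = {d' $ 1, d' $ 2, d' $ 3}"
    using singular_values_svd_diag [OF F svd] singular_values_svd_diag [OF F svd'] by simp
  with svd_diag_distinct [OF F svd] svd_diag_distinct [OF F svd'] show ?thesis
    unfolding vec_eq_iff forall_3 set_eq_iff insert_iff empty_iff by smt
qed

lemma svd_unique_up_to_signs:
  assumes F: "F \<in> distinct_pos_sv"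
    and svd: "is_svd F U (diag_mat d) V" and svd': "is_svd F U' S' V'"
  obtains e where "orthogonal_matrix (diag_mat e)"
    "U' = U ** diag_mat e" "S' = diag_mat d" "V' = V ** diag_mat e"
proof -
  have S': "S' = diag_mat d"
    using svd_diag_unique [OF F svd] is_svd_diag_mat [OF svd'] svd' by metis
  have V: "orthogonal_matrix V" and V': "orthogonal_matrix V'"
    using svd svd' by (auto simp: is_svd_def O3_def)
  have pos: "d $ i > 0" for i
    using svd_diag_distinct [OF F svd] exhaust_3 [of i] by force
  have inj: "i = j" if "d $ i = d $ j" for i j
    using svd_diag_distinct [OF F svd] exhaust_3 [of i] exhaust_3 [of j] that by force
  define D where "D = transpose V ** V'"
  have VD: "V' = V ** D"
    using V by (simp add: D_def orthogonal_matrix_cancel_left)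
  let ?S2 = "diag_mat (\<chi> i. (d $ i)\<^sup>2)"
  have "V ** ?S2 ** transpose V = V' ** ?S2 ** transpose V'"
    using is_svd_gram [OF svd] is_svd_gram svd' S' by metis
  then have "transpose V ** (V ** ?S2 ** transpose V) ** V'
      = transpose V ** (V' ** ?S2 ** transpose V') ** V'"
    by simp
  then have comm: "?S2 ** D = D ** ?S2"
    using V V' by (simp add: D_def orthogonal_matrix_cancel_left transpose_mult_self_orthogonal
        flip: matrix_mul_assoc)
  have off: "D $ i $ j = 0" if "i \<noteq> j" for i j
  proof -
    have "(d $ i)\<^sup>2 * D $ i $ j = D $ i $ j * (d $ j)\<^sup>2"
      using comm by (simp add: vec_eq_iff)
    \<comment> \<open>Squaring is injective on positive numbers, so the squared entries are distinct
      as well.\<close>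
    moreover have "(d $ i)\<^sup>2 \<noteq> (d $ j)\<^sup>2"
      using inj that pos [of i] pos [of j] by force
    ultimately show ?thesis
      by simp
  qed
  define e where "e = (\<chi> i. D $ i $ i)"
  have D: "D = diag_mat e"
    using off by (simp add: e_def vec_eq_iff)
  \<comment> \<open>The left factor is recovered from \<open>F ** V'\<close>: \<open>D\<close> is
    diagonal and commutes with \<open>diag_mat d\<close>, whose positive entries can then be
    cancelled column by column.\<close>
  have "U' ** diag_mat d = F ** V'"
    using svd' V' by (simp add: S' is_svd_def orthogonal_matrix_cancel)
  also have "\<dots> = U ** diag_mat d ** D"
    using svd V by (simp add: VD is_svd_def orthogonal_matrix_cancel_left flip: matrix_mul_assoc)
  also have "\<dots> = U ** D ** diag_mat d"
    by (simp add: D vec_eq_iff)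
  finally have "(U' ** diag_mat d) $ i $ j = (U ** D ** diag_mat d) $ i $ j" for i j
    by simp
  then have "U' = U ** D"
    using pos unfolding vec_eq_iff by (metis matrix_mult_diag_mat_nth mult_cancel_right less_irrefl)
  moreover have "orthogonal_matrix D"
    using V V' by (simp add: D_def orthogonal_matrix_mul)
  ultimately show ?thesis
    using that S' VD D by simp
qed

section \<open>Existence of the SVD\<close>

lemma symmetric_eigenvectors_orthogonal:
  fixes A :: "real^'n^'n"
  assumes "transpose A = A" "A *v v = a *\<^sub>R v" "A *v w = b *\<^sub>R w" "a \<noteq> b"
  shows "orthogonal v w"
proof -
  have "(A *v v) \<bullet> w = v \<bullet> (A *v w)"
    using assms(1) by (metis dot_lmul_matrix transpose_matrix_vector)
  then show ?thesis
    using assms by (simp add: orthogonal_def)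
qed

lemma card_3_sorted:
  assumes "card A = 3"
  obtains a b c :: "'a :: linorder" where "A = {a, b, c}" "a > b" "b > c"
proof -
  obtain x y z where A: "A = {x, y, z}" "x \<noteq> y" "y \<noteq> z" "x \<noteq> z"
    using assms by (auto simp: card_Suc_eq numeral_3_eq_3)
  then show ?thesis
    using that [of x y z] that [of x z y] that [of y x z] that [of y z x] that [of z x y]
      that [of z y x] by (metis insert_commute linorder_neqE)
qed

text \<open>Provides the base point for the count of SVDs. The eigenvalues of
  \<open>transpose F ** F\<close> are distinct, so its normalised eigenvectors are the columns of an
  orthogonal \<open>V\<close>; positivity of the singular values allows \<open>U\<close> to be
  solved for.\<close>

lemma distinct_pos_sv_has_svd:
  assumes F: "F \<in> distinct_pos_sv"
  obtains U d V where "is_svd F U (diag_mat d) V"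
proof -
  obtain a b c where abc: "{s. singular_value F s} = {a, b, c}" "a > b" "b > c"
    using F card_3_sorted by (metis (mono_tags, lifting) distinct_pos_sv_def mem_Collect_eq)
  define d :: "real^3" where "d = vector [a, b, c]"
  have d: "d $ 1 = a" "d $ 2 = b" "d $ 3 = c"
    by (simp_all add: d_def)
  have sv: "singular_value F (d $ i)" for i
    using abc(1) exhaust_3 [of i] d by auto
  have pos: "d $ i > 0" for i
    using sv F by (auto simp: distinct_pos_sv_def)
  have inj: "i = j" if "d $ i = d $ j" for i j
    using abc d exhaust_3 [of i] exhaust_3 [of j] that by force
  let ?A = "transpose F ** F"
  obtain v where v: "\<And>i. v i \<noteq> 0" "\<And>i. ?A *v v i = (d $ i)\<^sup>2 *\<^sub>R v i"
    using sv unfolding singular_value_def by metis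
  define V :: "real^3^3" where "V = (\<chi> i j. (v j /\<^sub>R norm (v j)) $ i)"
  have col: "column j V = v j /\<^sub>R norm (v j)" for j
    by (simp add: V_def column_def vec_eq_iff)
  have orth: "orthogonal (v i) (v j)" if "i \<noteq> j" for i j
  proof (rule symmetric_eigenvectors_orthogonal [OF _ v(2) v(2)])
    show "(d $ i)\<^sup>2 \<noteq> (d $ j)\<^sup>2"
      using inj that pos [of i] pos [of j] by force
  qed (simp add: matrix_transpose_mul)
  have V: "orthogonal_matrix V"
    using orth v(1) by (auto simp: orthogonal_matrix_orthonormal_columns col orthogonal_clauses)
  have "column j (?A ** V) = (d $ j)\<^sup>2 *\<^sub>R column j V" for j
  proof -
    have "column j (?A ** V) = ?A *v column j V"
      by (simp add: matrix_vector_mul_assoc flip: matrix_vector_mult_basis)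
    then show ?thesis
      by (simp add: col v(2) matrix_vector_mult_scaleR)
  qed
  then have AV: "?A ** V = V ** diag_mat (\<chi> i. (d $ i)\<^sup>2)"
    by (simp add: vec_eq_iff column_def mult.commute)
  have nz: "d $ i \<noteq> 0" for i
    using pos by (metis less_irrefl)
  let ?I = "diag_mat (\<chi> i. inverse (d $ i))"
  \<comment> \<open>The only choice compatible with \<open>F ** V = U ** diag_mat d\<close>.\<close>
  define U where "U = F ** V ** ?I"
  have "transpose U ** U = ?I ** (transpose V ** (?A ** V)) ** ?I"
    by (simp add: U_def matrix_transpose_mul matrix_mul_assoc)
  also have "\<dots> = ?I ** diag_mat (\<chi> i. (d $ i)\<^sup>2) ** ?I"
    using V by (simp add: AV orthogonal_matrix_cancel_left)
  also have "\<dots> = mat 1"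
    using nz by (simp add: vec_eq_iff mat_def power2_eq_square mult.assoc)
  finally have U: "orthogonal_matrix U"
    by (simp add: orthogonal_matrix)
  have "?I ** diag_mat d = mat 1"
    using nz by (simp add: vec_eq_iff mat_def)
  then have "U ** diag_mat d ** transpose V = F"
    using V by (simp add: U_def orthogonal_matrix_cancel flip: matrix_mul_assoc)
      (simp add: transpose_mult_self_orthogonal)
  with U V have "is_svd F U (diag_mat d) V"
    using abc d pos [of 3] by (auto simp: is_svd_def O3_def)
  then show ?thesis
    by (rule that)
qed

section \<open>Counting the oriented SVDs\<close>

text \<open>Diagonal matrices commute and the signs square to 1, so the two copies of
  \<open>diag_mat e\<close> cancel around \<open>diag_mat d\<close>.\<close>

lemma is_svd_mult_signs:
  assumes svd: "is_svd F U (diag_mat d) V" and e: "orthogonal_matrix (diag_mat e)"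
  shows "is_svd F (U ** diag_mat e) (diag_mat d) (V ** diag_mat e)"
proof -
  have "diag_mat e ** diag_mat d ** diag_mat e = diag_mat d"
    using e by (force simp: orthogonal_diag_mat_iff vec_eq_iff square_eq_1_iff)
  then have "U ** diag_mat e ** diag_mat d ** transpose (V ** diag_mat e)
      = U ** diag_mat d ** transpose V"
    by (simp add: matrix_transpose_mul matrix_mul_assoc) (metis matrix_mul_assoc)
  with assms show ?thesis
    by (simp add: is_svd_def O3_def orthogonal_matrix_mul)
qed

lemma det_distinct_pos_sv:
  assumes F: "F \<in> distinct_pos_sv" and svd: "is_svd F U S V"
  shows "det F \<noteq> 0" "det F > 0 \<longleftrightarrow> det U * det V = 1"
proof -
  obtain d where S: "S = diag_mat d"
    using is_svd_diag_mat [OF svd] by blast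
  have "det S > 0"
    using svd_diag_distinct [OF F svd [unfolded S]] by (simp add: S det_diag_mat)
  moreover have "det F = det U * det S * det V"
    using svd by (simp add: is_svd_def det_mul det_transpose)
  moreover have "det U = 1 \<or> det U = - 1" "det V = 1 \<or> det V = - 1"
    using svd O3_det by (auto simp: is_svd_def)
  ultimately show "det F \<noteq> 0" "det F > 0 \<longleftrightarrow> det U * det V = 1"
    by auto
qed

text \<open>Once \<open>det V = 1\<close>, the sign of the nonzero \<open>det F\<close> determines
  \<open>det U\<close>, so both orientation cases reduce to one condition on
  \<open>V\<close>.\<close>

lemma oriented_svds_eq:
  assumes F: "F \<in> distinct_pos_sv"
  shows "oriented_svds F = {(U, S, V). is_svd F U S V \<and> det V = 1}"
proof -
  have "is_svd F U S V \<Longrightarrow> U \<in> O3 \<and> V \<in> O3 \<and> (det U = 1 \<or> det U = - 1)" for U S V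
    using O3_det by (auto simp: is_svd_def)
  then show ?thesis
    using det_distinct_pos_sv [OF F]
    by (fastforce simp: oriented_svds_def SO3_iff not_less)
qed

text \<open>Relative to one fixed SVD, the oriented ones are parametrised bijectively by the first
  two signs of the pattern.\<close>

lemma card_oriented_svds:
  assumes F: "F \<in> distinct_pos_sv"
  shows "card (oriented_svds F) = 4"
proof -
  obtain U0 d V0 where svd0: "is_svd F U0 (diag_mat d) V0"
    using distinct_pos_sv_has_svd [OF F] .
  have V0: "V0 \<in> O3"
    using svd0 by (simp add: is_svd_def)
  \<comment> \<open>The third sign is the one that makes \<open>det V = 1\<close>.\<close>
  define e :: "real \<times> real \<Rightarrow> real^3" where "e = (\<lambda>(a, b). vector [a, b, a * b * det V0])"
  let ?f = "\<lambda>p. (U0 ** diag_mat (e p), diag_mat d, V0 ** diag_mat (e p))"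
  let ?P = "{1, - 1} \<times> {1, - 1} :: (real \<times> real) set"
  have "oriented_svds F = ?f ` ?P"
  proof (intro equalityI subsetI)
    fix x assume x: "x \<in> oriented_svds F"
    obtain U S V where xeq: "x = (U, S, V)"
      by (cases x)
    then have svd: "is_svd F U S V" and "det V = 1"
      using x by (auto simp: oriented_svds_eq [OF F])
    obtain w where w: "orthogonal_matrix (diag_mat w)"
      "U = U0 ** diag_mat w" "S = diag_mat d" "V = V0 ** diag_mat w"
      using svd_unique_up_to_signs [OF F svd0 svd] .
    have signs: "w $ 1 = 1 \<or> w $ 1 = - 1" "w $ 2 = 1 \<or> w $ 2 = - 1" "w $ 3 = 1 \<or> w $ 3 = - 1"
      using w(1) by (auto simp: orthogonal_diag_mat_iff)
    moreover have "det V0 * (w $ 1 * w $ 2 * w $ 3) = 1"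
      using \<open>det V = 1\<close> by (simp add: w det_mul det_diag_mat)
    \<comment> \<open>All factors of the product are 1 or -1, hence their own inverses.\<close>
    ultimately have "w $ 3 = w $ 1 * w $ 2 * det V0"
      using O3_det [OF V0] by auto
    then have "w = e (w $ 1, w $ 2)"
      by (simp add: e_def vec_eq_iff forall_3)
    then show "x \<in> ?f ` ?P"
      using signs xeq w by (intro image_eqI [of _ _ "(w $ 1, w $ 2)"]) auto
  next
    fix x assume "x \<in> ?f ` ?P"
    then obtain p where p: "p \<in> ?P" and x: "x = ?f p"
      by blast
    have "orthogonal_matrix (diag_mat (e p))"
      using p O3_det [OF V0] by (auto simp: e_def orthogonal_diag_mat_iff forall_3)
    moreover have "det (V0 ** diag_mat (e p)) = 1"
      using p O3_det [OF V0] by (auto simp: e_def det_mul det_diag_mat)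
    ultimately show "x \<in> oriented_svds F"
      using is_svd_mult_signs [OF svd0] by (simp add: x oriented_svds_eq [OF F])
  qed
  moreover have "inj_on ?f ?P"
  proof (rule inj_onI)
    fix p q assume "?f p = ?f q"
    \<comment> \<open>The third component alone suffices: \<open>V0\<close> is invertible, and the
      first two entries of \<open>e p\<close> are the pair \<open>p\<close>.\<close>
    then have "transpose V0 ** (V0 ** diag_mat (e p)) = transpose V0 ** (V0 ** diag_mat (e q))"
      by simp
    then have "diag_mat (e p) = diag_mat (e q)"
      using V0 by (simp add: O3_def orthogonal_matrix_cancel_left)
    then have "e p $ i = e q $ i" for i
      by (metis diag_mat_nth)
    then show "p = q"
      by (metis (no_types, lifting) e_def case_prod_unfold vector_3(1,2) prod_eqI)
  qed
  ultimately show ?thesis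
    by (simp add: card_image card_cartesian_product)
qed

text \<open>These are the instances of \<open>O3_eq_of_columns\<close> with \<open>det V = 1\<close>
  and with \<open>det U\<close> equal to the sign of \<open>det F\<close>.\<close>

lemma oriented_svds_of_columns:
  assumes F: "F \<in> distinct_pos_sv" and x: "(U, S, V) \<in> oriented_svds F"
  shows "det F > 0 \<Longrightarrow> U = of_columns (column 1 U) (column 2 U) (cross3 (column 1 U) (column 2 U))"
    and "det F < 0 \<Longrightarrow> U = of_columns (column 1 U) (column 2 U) (- cross3 (column 1 U) (column 2 U))"
    and "V = of_columns (column 1 V) (column 2 V) (cross3 (column 1 V) (column 2 V))"
proof -
  have svd: "is_svd F U S V" and "det V = 1"
    using x by (auto simp: oriented_svds_eq [OF F])
  then have UV: "U \<in> O3" "V \<in> O3"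
    by (auto simp: is_svd_def)
  have U: "det F > 0 \<longleftrightarrow> det U = 1"
    using det_distinct_pos_sv [OF F svd] \<open>det V = 1\<close> by simp
  show "V = of_columns (column 1 V) (column 2 V) (cross3 (column 1 V) (column 2 V))"
    using O3_eq_of_columns [OF UV(2)] \<open>det V = 1\<close> by simp
  show "U = of_columns (column 1 U) (column 2 U) (cross3 (column 1 U) (column 2 U))" if "det F > 0"
    using O3_eq_of_columns [OF UV(1)] U that by simp
  show "U = of_columns (column 1 U) (column 2 U) (- cross3 (column 1 U) (column 2 U))" if "det F < 0"
  proof -
    have "det U = - 1"
      using U that O3_det [OF UV(1)] by auto
    then show ?thesis
      using O3_eq_of_columns [OF UV(1)] by simp
  qed
qed

theorem proposition4p1:
  shows "output_bi_equivariant SO3 (*v) (*v) joint_act UNIV UNIV tensor_product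
    \<and> (\<forall>F\<in>distinct_pos_sv.
         card (oriented_svds F) = 4 \<and>
         (\<forall>(U, S, V)\<in>oriented_svds F.
            (det F > 0 \<longrightarrow>
               U = of_columns (column 1 U) (column 2 U) (cross3 (column 1 U) (column 2 U))) \<and>
            (det F < 0 \<longrightarrow>
               U = of_columns (column 1 U) (column 2 U) (- cross3 (column 1 U) (column 2 U))) \<and>
            V = of_columns (column 1 V) (column 2 V) (cross3 (column 1 V) (column 2 V))))
    \<and> (\<forall>\<sigma> \<sigma>'. input_bi_equivariant SO3 joint_act set_act set_act distinct_pos_sv (svd_map \<sigma> \<sigma>'))
    \<and> (\<forall>N \<sigma>. orthogonally_invariant_norm N \<or> N \<in> {operator_norm, frobenius_norm, trace_norm} \<longrightarrow>
         input_output_bi_equivariant SO3 joint_act joint_act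
           {F \<in> distinct_pos_sv. F \<noteq> 0} (norm_map N \<sigma>))"
  using tensor_product_output_bi_equivariant card_oriented_svds oriented_svds_of_columns
    svd_map_input_bi_equivariant norm_map_input_output_bi_equivariant
  by blast

end
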